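(* Rabin's randomized mutual exclusion algorithm (as described in the context) does not satisfy the strong, without-knowledge probabilistic no-lockout property. Indeed, there is an adversary $\mathcal{A}$ such that for every round $k\ge 1$ and every $m$ with $2\le m\le n-1$, $$\mathbf{P}_{\mathcal{A}}[1\in\mathcal{P}(k),\ |\mathcal{P}(k)|=m]\neq 0 \quad\text{but}\quad \mathbf{P}_{\mathcal{A}}[W_1(k)\mid 1\in\mathcal{P}(k),\ |\mathcal{P}(k)|=m]=0 .$$
   Context: Rabin's algorithm. There are $n$ processes $1,\dots,n$ sharing a variable $V=(S,B,R)$ with $S\in\{0,1\}$ (initially $0$), $B\in\{0,1,\dots,b\}$ where $b=\lceil\log_2 n\rceil+4$ (initially $0$), and $R\in\{0,\dots,99\}$ (initially uniformly random). Each process $i$ has local variables $B_i\in\{0,\dots,b\}$ (initially $1$) and $R_i\in\{0,\dots,99\}\cup\{\perp\}$ (initially $\perp$). Each process cycles through regions Try, Crit, Exit, Rem. Try: "while $V\neq(0,B_i,R_i)$ do { if ($V.R\neq R_i$) or ($V.B<B_i$) then $B_i\leftarrow$ random; $V.B\leftarrow\max(V.B,B_i)$; $R_i\leftarrow V.R$; unlock; lock }; $V\leftarrow(1,0,\text{random})$; unlock"; then Crit; Exit: "lock; $V.S\leftarrow 0$; $R_i\leftarrow\perp$; $B_i\leftarrow 0$; unlock"; then Rem; then "lock" and Try again. Everything between a lock and the next unlock is one atomic step. "$B_i\leftarrow$ random" draws a fresh lottery value, independent of everything else, with $\mathbf{P}[=l]=2^{-l}$ for $1\le l\le b-1$ and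 $\mathbf{P}[=b]=2^{-(b-1)}$; "random" for the $R$ field is uniform on $\{0,\dots,99\}$, independent of everything else. The critical section is free when $S=0$. Model. A run of an (partial) execution is the sequence of triples $(p_t,old_t,new_t)$ saying that process $p_t$ takes the $t$-th step and moves from region $old_t$ to region $new_t$ during it. An adversary is a map $\mathcal{A}$ from finite runs to $\{1,\dots,n\}$ giving the process that takes the next step (so it sees only region changes). For each adversary $\mathcal{A}$, the random choices induce a probability measure $\mathbf{P}_{\mathcal{A}}$ on executions. A round is a maximal execution fragment containing exactly one transition Try$\to$Crit, at its end. A process participates in a round if it takes a step while in Try during that round. $\mathcal{P}(k)$ is the set of processes participating in round $k$ (empty if there are fewer than $k$ rounds); $W_i(k)$ is the event that process $i$ enters Crit at the end of round $k$. *)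

theory Defs
  imports "HOL-Probability.Probability"
begin

section \<open>Rabin's algorithm\<close>

datatype region = Try | Crit | Exit | Rem

instance region :: countable
  by countable_datatype

record config =
  shS :: nat
  shB :: nat
  shR :: nat
  locB :: "nat \<Rightarrow> nat"
  locR :: "nat \<Rightarrow> nat option"  \<comment> \<open>\<^term>\<open>None\<close> stands for \<open>\<bottom>\<close>\<close>
  reg :: "nat \<Rightarrow> region"

definition bmax :: "nat \<Rightarrow> nat" where
  "bmax n = nat \<lceil>log 2 (real n)\<rceil> + 4"

definition lottery :: "nat \<Rightarrow> nat pmf" where
  "lottery b = embed_pmf (\<lambda>l. if 1 \<le> l \<and> l \<le> b - 1 then (1/2) ^ l
                               else if l = b then (1/2) ^ (b - 1) else 0)"

definition uniform_R :: "nat pmf" where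
  "uniform_R = pmf_of_set {0..99}"

text \<open>All processes start in the remainder region, the usual convention for mutual exclusion.\<close>

definition init_config :: "nat \<Rightarrow> config" where
  "init_config r = \<lparr>shS = 0, shB = 0, shR = r, locB = (\<lambda>_. 1), locR = (\<lambda>_. None), reg = (\<lambda>_. Rem)\<rparr>"

text \<open>
  One atomic step of process \<open>i\<close>. The pair \<open>(l, r)\<close> supplies the fresh random values of this step:
  \<open>l\<close> is used if the step executes ``\<open>B\<^sub>i\<close> := random'', \<open>r\<close> if it assigns a random value to the
  \<open>R\<close> field. A step in \<^const>\<open>Try\<close> is one evaluation of the loop test (after acquiring the lock),
  followed either by the loop body or by the assignment after the loop. In the code, the updates of
  \<open>V.B\<close> and \<open>R\<^sub>i\<close> have no effect when the guard of the conditional is false, so it is irrelevant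
  whether they belong to the conditional. The moves from \<^const>\<open>Crit\<close> to \<^const>\<open>Exit\<close> and from
  \<^const>\<open>Rem\<close> to \<^const>\<open>Try\<close> (after which the lock is requested) do not access the shared variable.
\<close>

fun step :: "nat \<Rightarrow> nat \<times> nat \<Rightarrow> config \<Rightarrow> config" where
  "step i (l, r) c =
    (case reg c i of
       Try \<Rightarrow>
         if shS c = 0 \<and> shB c = locB c i \<and> Some (shR c) = locR c i
         then c\<lparr>shS := 1, shB := 0, shR := r, reg := (reg c)(i := Crit)\<rparr>
         else if Some (shR c) \<noteq> locR c i \<or> shB c < locB c i
         then c\<lparr>shB := max (shB c) l, locB := (locB c)(i := l), locR := (locR c)(i := Some (shR c))\<rparr>
         else c
     | Crit \<Rightarrow> c\<lparr>reg := (reg c)(i := Exit)\<rparr>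
     | Exit \<Rightarrow> c\<lparr>shS := 0, locB := (locB c)(i := 0), locR := (locR c)(i := None),
                 reg := (reg c)(i := Rem)\<rparr>
     | Rem \<Rightarrow> c\<lparr>reg := (reg c)(i := Try)\<rparr>)"


section \<open>Runs, adversaries and the induced probability measure\<close>

type_synonym move = "nat \<times> region \<times> region"

text \<open>
  In an execution \<open>\<alpha>\<close>, \<^term>\<open>fst (\<alpha> t)\<close> is the configuration before the step with index \<open>t\<close>
  (indices start at 0) and \<^term>\<open>snd (\<alpha> t)\<close> is the process taking that step.
\<close>

type_synonym execution = "nat \<Rightarrow> config \<times> nat"

definition move :: "execution \<Rightarrow> nat \<Rightarrow> move" where
  "move \<alpha> t = (let i = snd (\<alpha> t) in (i, reg (fst (\<alpha> t)) i, reg (fst (\<alpha> (Suc t))) i))"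

definition is_adversary :: "nat \<Rightarrow> (move list \<Rightarrow> nat) \<Rightarrow> bool" where
  "is_adversary n A \<longleftrightarrow> (\<forall>h. A h \<in> {1..n})"

primrec outcome :: "(move list \<Rightarrow> nat) \<Rightarrow> nat \<Rightarrow> (nat \<Rightarrow> nat \<times> nat) \<Rightarrow> nat \<Rightarrow> move list \<times> config" where
  "outcome A r \<omega> 0 = ([], init_config r)"
| "outcome A r \<omega> (Suc t) =
    (let (h, c) = outcome A r \<omega> t; i = A h; c' = step i (\<omega> t) c
     in (h @ [(i, reg c i, reg c' i)], c'))"

definition execution_of :: "(move list \<Rightarrow> nat) \<Rightarrow> nat \<times> (nat \<Rightarrow> nat \<times> nat) \<Rightarrow> execution" where
  "execution_of A = (\<lambda>(r, \<omega>) t. (snd (outcome A r \<omega> t), A (fst (outcome A r \<omega> t))))"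

definition choice_space :: "nat \<Rightarrow> (nat \<times> (nat \<Rightarrow> nat \<times> nat)) measure" where
  "choice_space n =
    measure_pmf uniform_R \<Otimes>\<^sub>M
    (\<Pi>\<^sub>M t\<in>(UNIV :: nat set). measure_pmf (pair_pmf (lottery (bmax n)) uniform_R))"

definition execution_space :: "execution measure" where
  "execution_space = (\<Pi>\<^sub>M t\<in>(UNIV :: nat set). count_space UNIV)"

definition exec_measure :: "nat \<Rightarrow> (move list \<Rightarrow> nat) \<Rightarrow> execution measure" where
  "exec_measure n A = distr (choice_space n) execution_space (execution_of A)"


section \<open>Rounds\<close>

definition enters_crit :: "execution \<Rightarrow> nat \<Rightarrow> bool" where
  "enters_crit \<alpha> t \<longleftrightarrow> snd (move \<alpha> t) = (Try, Crit)"

definition round_end :: "execution \<Rightarrow> nat \<Rightarrow> nat \<Rightarrow> bool" where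
  "round_end \<alpha> k t \<longleftrightarrow> enters_crit \<alpha> t \<and> card {u. u \<le> t \<and> enters_crit \<alpha> u} = k"

text \<open>The step indices of the \<open>k\<close>-th round (\<open>k \<ge> 1\<close>); empty if there are fewer than \<open>k\<close> rounds.\<close>

definition round_steps :: "execution \<Rightarrow> nat \<Rightarrow> nat set" where
  "round_steps \<alpha> k =
    {s. \<exists>t. round_end \<alpha> k t \<and> s \<le> t \<and> (\<forall>u. s \<le> u \<and> u < t \<longrightarrow> \<not> enters_crit \<alpha> u)}"

definition participants :: "execution \<Rightarrow> nat \<Rightarrow> nat set" where
  "participants \<alpha> k = {i. \<exists>s \<in> round_steps \<alpha> k. \<exists>new. move \<alpha> s = (i, Try, new)}"

definition wins :: "execution \<Rightarrow> nat \<Rightarrow> nat \<Rightarrow> bool" where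
  "wins \<alpha> i k \<longleftrightarrow> (\<exists>t. round_end \<alpha> k t \<and> move \<alpha> t = (i, Try, Crit))"

text \<open>
  Strong: the lower bound is \<open>c/m\<close> with \<open>m\<close> the number of participants. Without knowledge: the
  only conditioning is on the participation of \<open>i\<close> and on \<open>m\<close>, not on the past of the round.
\<close>

definition strong_no_lockout_without_knowledge :: "nat \<Rightarrow> bool" where
  "strong_no_lockout_without_knowledge n \<longleftrightarrow>
    (\<exists>c::real. c > 0 \<and>
      (\<forall>A. is_adversary n A \<longrightarrow>
        (\<forall>k\<ge>1. \<forall>i\<in>{1..n}. \<forall>m\<in>{1..n}.
          \<P>(\<alpha> in exec_measure n A. i \<in> participants \<alpha> k \<and> card (participants \<alpha> k) = m) \<noteq> 0 \<longrightarrow>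
          \<P>(\<alpha> in exec_measure n A. wins \<alpha> i k \<bar>
              i \<in> participants \<alpha> k \<and> card (participants \<alpha> k) = m) \<ge> c / real m)))"


section \<open>Well-definedness\<close>

lemma pmf_lottery:
  "pmf (lottery b) l = (if 1 \<le> l \<and> l \<le> b - 1 then (1/2) ^ l
                        else if l = b then (1/2) ^ (b - 1) else 0)"
proof -
  let ?f = "\<lambda>l. if 1 \<le> l \<and> l \<le> b - 1 then (1/2) ^ l
                 else if l = b then (1/2) ^ (b - 1) else (0::real)"
  have sum: "(\<Sum>l\<le>b. ?f l) = 1"
  proof (cases b)
    case 0
    then show ?thesis by simp
  next
    case (Suc d)
    have geo: "(\<Sum>l\<in>{1..d}. (1/2) ^ l) + (1/2) ^ d = (1::real)"
      by (induction d) auto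
    have "{..b} = insert 0 (insert b {1..d})"
      using Suc by auto
    moreover have "(\<Sum>l\<in>{1..d}. ?f l) = (\<Sum>l\<in>{1..d}. (1/2) ^ l)"
      using Suc by (intro sum.cong) auto
    ultimately show ?thesis
      using Suc geo by simp
  qed
  have "(\<integral>\<^sup>+ l. ennreal (?f l) \<partial>count_space UNIV) = (\<integral>\<^sup>+ l. ennreal (?f l) \<partial>count_space {..b})"
    by (rule nn_integral_count_space_eq) auto
  also have "\<dots> = (\<Sum>l\<le>b. ennreal (?f l))"
    by (simp add: nn_integral_count_space_finite)
  also have "\<dots> = ennreal (\<Sum>l\<le>b. ?f l)"
    by (rule sum_ennreal) auto
  finally have "(\<integral>\<^sup>+ l. ennreal (?f l) \<partial>count_space UNIV) = 1"
    unfolding sum by simp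
  then show ?thesis
    unfolding lottery_def by (subst pmf_embed_pmf) auto
qed

lemma outcome_cong:
  "(\<And>s. s < t \<Longrightarrow> \<omega> s = \<omega>' s) \<Longrightarrow> outcome A r \<omega> t = outcome A r \<omega>' t"
  by (induction t) auto

lemma prob_space_choice_space: "prob_space (choice_space n)"
proof -
  interpret P: product_prob_space "\<lambda>_. measure_pmf (pair_pmf (lottery (bmax n)) uniform_R)"
    "UNIV :: nat set"
    by standard
  interpret pair_prob_space "measure_pmf uniform_R"
    "\<Pi>\<^sub>M t\<in>(UNIV :: nat set). measure_pmf (pair_pmf (lottery (bmax n)) uniform_R)"
    by standard
  show ?thesis
    unfolding choice_space_def by (rule prob_space_axioms)
qed

lemma measurable_execution_of: "execution_of A \<in> choice_space n \<rightarrow>\<^sub>M execution_space"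
proof -
  let ?M = "choice_space n"
  have r: "fst \<in> ?M \<rightarrow>\<^sub>M count_space UNIV"
    unfolding choice_space_def by measurable
  have w: "(\<lambda>x. snd x t) \<in> ?M \<rightarrow>\<^sub>M count_space UNIV" for t
    unfolding choice_space_def by measurable
  have ws: "(\<lambda>x. map (snd x) [0..<t]) \<in> ?M \<rightarrow>\<^sub>M count_space UNIV" for t
  proof (induction t)
    case 0
    then show ?case by simp
  next
    case (Suc t)
    have "(\<lambda>x. (\<lambda>y z. y @ [z]) (map (snd x) [0..<t]) (snd x t)) \<in> ?M \<rightarrow>\<^sub>M count_space UNIV"
      by (rule measurable_compose_countable[OF _ Suc], rule measurable_compose_countable[OF _ w]) simp
    then show ?case by simp
  qed
  have "(\<lambda>x. execution_of A x t) \<in> ?M \<rightarrow>\<^sub>M count_space UNIV" for t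
  proof -
    have "(\<lambda>x. (\<lambda>y z. execution_of A (z, \<lambda>s. y ! s) t) (map (snd x) [0..<t]) (fst x))
        \<in> ?M \<rightarrow>\<^sub>M count_space UNIV"
      by (rule measurable_compose_countable[OF _ ws], rule measurable_compose_countable[OF _ r]) simp
    moreover have "execution_of A (fst x, \<lambda>s. map (snd x) [0..<t] ! s) t = execution_of A x t" for x
      unfolding execution_of_def case_prod_beta
      using outcome_cong[of t "\<lambda>s. map (snd x) [0..<t] ! s" "snd x"] by simp
    ultimately show ?thesis by simp
  qed
  then show ?thesis
    unfolding execution_space_def
    by (intro measurable_PiM_single') (auto simp: choice_space_def)
qed

lemma prob_space_exec_measure: "prob_space (exec_measure n A)"
  unfolding exec_measure_def
  by (rule prob_space.prob_space_distr[OF prob_space_choice_space measurable_execution_of])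

lemma sets_exec_measure: "sets (exec_measure n A) = sets execution_space"
  by (simp add: exec_measure_def)

lemma measurable_move: "(\<lambda>\<alpha>. move \<alpha> t) \<in> execution_space \<rightarrow>\<^sub>M count_space UNIV"
proof -
  have a: "(\<lambda>\<alpha>. \<alpha> s) \<in> execution_space \<rightarrow>\<^sub>M count_space UNIV" for s
    unfolding execution_space_def by measurable
  have i: "(\<lambda>\<alpha>. snd (\<alpha> s)) \<in> execution_space \<rightarrow>\<^sub>M count_space UNIV" for s
    by (rule measurable_compose[OF a]) simp
  have g: "(\<lambda>\<alpha>. reg (fst (\<alpha> s)) i) \<in> execution_space \<rightarrow>\<^sub>M count_space UNIV" for s i
    by (rule measurable_compose[OF a]) simp
  have "(\<lambda>\<alpha>. (\<lambda>i \<alpha>. (\<lambda>x \<alpha>. (\<lambda>y \<alpha>. (i, x, y)) (reg (fst (\<alpha> (Suc t))) i) \<alpha>) (reg (fst (\<alpha> t)) i) \<alpha>)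
      (snd (\<alpha> t)) \<alpha>) \<in> execution_space \<rightarrow>\<^sub>M count_space UNIV"
    by (rule measurable_compose_countable[OF _ i], rule measurable_compose_countable[OF _ g],
        rule measurable_compose_countable[OF _ g]) simp
  then show ?thesis
    by (simp add: move_def Let_def)
qed

lemma measurable_enters_crit [measurable]: "Measurable.pred execution_space (\<lambda>\<alpha>. enters_crit \<alpha> t)"
  unfolding enters_crit_def by (rule measurable_compose[OF measurable_move]) simp

lemma measurable_move_eq [measurable]: "Measurable.pred execution_space (\<lambda>\<alpha>. move \<alpha> t = x)"
  by (rule measurable_compose[OF measurable_move]) simp

lemma measurable_round_end [measurable]: "Measurable.pred execution_space (\<lambda>\<alpha>. round_end \<alpha> k t)"
  unfolding round_end_def by measurable

lemma measurable_participants [measurable]: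
  "Measurable.pred execution_space (\<lambda>\<alpha>. i \<in> participants \<alpha> k)"
  unfolding participants_def round_steps_def Bex_def mem_Collect_eq by measurable

lemma measurable_card_participants [measurable]:
  "Measurable.pred execution_space (\<lambda>\<alpha>. card (participants \<alpha> k) = m)"
  by measurable

lemma measurable_wins [measurable]: "Measurable.pred execution_space (\<lambda>\<alpha>. wins \<alpha> i k)"
  unfolding wins_def by measurable

end

theory Submission
  imports Defs
begin

text \<open>
  The adversary first brings all processes into \<^const>\<open>Try\<close> and then schedules
  \<open>1, 2, 2, 3, 3, \<dots>, n, n, 1, 1, \<dots>\<close> until some process \<open>w\<close> enters \<^const>\<open>Crit\<close>; it then lets \<open>w\<close>
  return to \<^const>\<open>Try\<close> and starts over. Process 1 can only win at its first step, when it is the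
  only participant, or after everybody has participated, so it never wins with \<open>m\<close> participants if
  \<open>2 \<le> m \<le> n - 1\<close>. On the other hand, it is possible that process 2 wins the first \<open>k - 1\<close> rounds
  and that in round \<open>k\<close> the processes \<open>1\<close> and \<open>m\<close> draw the lottery value 2 and all processes between
  them draw 1; then \<open>m\<close> wins and the participants are \<open>1, \<dots>, m\<close>.
\<close>

section \<open>The adversary\<close>

text \<open>A process with \<open>locR\<close> reset uses its first step to draw a lottery value and
  its second to enter \<open>Crit\<close> if the draw equals \<open>shB\<close>. In
  \<open>schedule\<close>, process 1 gets only the drawing step.\<close>

definition double_steps :: "nat \<Rightarrow> nat \<Rightarrow> nat list" where
  "double_steps i n = concat (map (\<lambda>j. [j, j]) [i..<Suc n])"

definition schedule :: "nat \<Rightarrow> nat list" where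
  "schedule n = 1 # double_steps 2 n"

text \<open>The default 1 realises the tail 1, 1, ... of the schedule once the queue is
  exhausted.\<close>

definition front :: "nat list \<Rightarrow> nat" where
  "front q = (if q = [] then 1 else hd q)"

text \<open>The mover is \<open>front q\<close>, so the pair of regions is the only new information.
  The winner gets three steps: \<open>Crit\<close> to \<open>Exit\<close>, \<open>Exit\<close> to
  \<open>Rem\<close>, \<open>Rem\<close> to \<open>Try\<close>.\<close>

definition requeue :: "nat \<Rightarrow> nat list \<Rightarrow> region \<times> region \<Rightarrow> nat list" where
  "requeue n q m = (if m = (Try, Crit) then replicate 3 (front q) @ schedule n else tl q)"

definition queue :: "nat \<Rightarrow> move list \<Rightarrow> nat list" where
  "queue n h = foldl (\<lambda>q m. requeue n q (snd m)) ([1..<Suc n] @ schedule n) h"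

definition adversary :: "nat \<Rightarrow> move list \<Rightarrow> nat" where
  "adversary n h = front (queue n h)"

lemma double_steps_simps:
  "double_steps i n = (if i \<le> n then i # i # double_steps (Suc i) n else [])"
  by (simp add: double_steps_def upt_conv_Cons del: upt_Suc)

lemma set_double_steps: "set (double_steps i n) = {i..n}"
  by (auto simp: double_steps_def)

lemma set_schedule: "n \<ge> 1 \<Longrightarrow> set (schedule n) = {1..n}"
  by (auto simp: schedule_def set_double_steps)

lemma front_in: "n \<ge> 1 \<Longrightarrow> set q \<subseteq> {1..n} \<Longrightarrow> front q \<in> {1..n}"
  by (cases q) (auto simp: front_def)

lemma set_requeue:
  "n \<ge> 1 \<Longrightarrow> set q \<subseteq> {1..n} \<Longrightarrow> set (requeue n q m) \<subseteq> {1..n}"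
  using front_in[of n q] list.set_sel(2)[of q]
  by (cases q) (auto simp: requeue_def set_schedule)

lemma set_queue: "n \<ge> 1 \<Longrightarrow> set (queue n h) \<subseteq> {1..n}"
proof (induction h rule: rev_induct)
  case Nil
  then show ?case by (auto simp: queue_def set_schedule)
next
  case (snoc m h)
  then show ?case using set_requeue[of n "queue n h" "snd m"] by (simp add: queue_def)
qed

lemma is_adversary_adversary: "n \<ge> 1 \<Longrightarrow> is_adversary n (adversary n)"
  unfolding is_adversary_def adversary_def using front_in[OF _ set_queue] by blast


section \<open>Rounds in progress\<close>

definition wins_before :: "execution \<Rightarrow> nat \<Rightarrow> nat" where
  "wins_before \<alpha> t = card {u. u < t \<and> enters_crit \<alpha> u}"

text \<open>The step \<open>s\<close> itself must not enter \<open>Crit\<close>, because such a step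
  belongs to the round that it closes.\<close>

definition participants_before :: "execution \<Rightarrow> nat \<Rightarrow> nat set" where
  "participants_before \<alpha> t =
    {i. \<exists>s<t. (\<forall>u. s \<le> u \<and> u < t \<longrightarrow> \<not> enters_crit \<alpha> u) \<and> (\<exists>new. move \<alpha> s = (i, Try, new))}"

lemma wins_before_Suc:
  "wins_before \<alpha> (Suc t) = (if enters_crit \<alpha> t then Suc (wins_before \<alpha> t) else wins_before \<alpha> t)"
proof -
  have "{u. u < Suc t \<and> enters_crit \<alpha> u} =
      (if enters_crit \<alpha> t then insert t {u. u < t \<and> enters_crit \<alpha> u} else {u. u < t \<and> enters_crit \<alpha> u})"
    by (auto simp: less_Suc_eq)
  then show ?thesis by (simp add: wins_before_def)
qed

lemma participants_before_Suc:
  "participants_before \<alpha> (Suc t) =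
    (if enters_crit \<alpha> t then {}
     else if fst (snd (move \<alpha> t)) = Try then insert (fst (move \<alpha> t)) (participants_before \<alpha> t)
     else participants_before \<alpha> t)"
proof (cases "enters_crit \<alpha> t")
  case True
  then show ?thesis
    by (auto simp: participants_before_def dest!: spec[of _ t])
next
  case False
  then show ?thesis
    by (cases "move \<alpha> t") (auto simp: participants_before_def less_Suc_eq)
qed

text \<open>\<open>round_end\<close> counts the entry at \<open>t\<close> itself and
  \<open>wins_before\<close> does not, hence the \<open>Suc\<close>.\<close>

lemma round_end_iff:
  "round_end \<alpha> k t \<longleftrightarrow> enters_crit \<alpha> t \<and> Suc (wins_before \<alpha> t) = k"
  using wins_before_Suc[of \<alpha> t] by (auto simp: round_end_def wins_before_def less_Suc_eq_le)

lemma mono_wins_before: "s \<le> t \<Longrightarrow> wins_before \<alpha> s \<le> wins_before \<alpha> t"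
  unfolding wins_before_def by (intro card_mono) auto

lemma round_end_unique:
  assumes "round_end \<alpha> k s" "round_end \<alpha> k t"
  shows "s = t"
  using assms mono_wins_before[of "Suc s" t \<alpha>] mono_wins_before[of "Suc t" s \<alpha>]
  by (cases s t rule: linorder_cases) (auto simp: round_end_iff wins_before_Suc)

text \<open>The closing step is itself taken from \<open>Try\<close>, and
  \<open>participants_before\<close> stops just short of it, so the winner is inserted
  separately.\<close>

lemma participants_round_end:
  assumes "round_end \<alpha> k t"
  shows "participants \<alpha> k = insert (fst (move \<alpha> t)) (participants_before \<alpha> t)"
proof -
  have "round_end \<alpha> k s \<longleftrightarrow> s = t" for s
    using assms round_end_unique by blast
  then have "round_steps \<alpha> k = {s. s \<le> t \<and> (\<forall>u. s \<le> u \<and> u < t \<longrightarrow> \<not> enters_crit \<alpha> u)}"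
    by (simp add: round_steps_def)
  moreover have "snd (move \<alpha> t) = (Try, Crit)"
    using assms by (simp add: round_end_def enters_crit_def)
  ultimately show ?thesis
    by (cases "move \<alpha> t") (auto simp: participants_def participants_before_def order_le_less)
qed


section \<open>Monitored runs\<close>

text \<open>
  The state of the adversary, the configuration, the number of completed rounds and the set of
  processes that have already participated in the current round.
\<close>

type_synonym monitor = "nat list \<times> config \<times> nat \<times> nat set"

fun monitor_step :: "nat \<Rightarrow> nat \<times> nat \<Rightarrow> monitor \<Rightarrow> monitor" where
  "monitor_step n x (q, c, k, P) =
    (let i = front q; c' = step i x c; m = (reg c i, reg c' i)
     in (requeue n q m, c',
         if m = (Try, Crit) then Suc k else k,
         if m = (Try, Crit) then {} else if fst m = Try then insert i P else P))"

primrec monitor :: "nat \<Rightarrow> nat \<Rightarrow> (nat \<Rightarrow> nat \<times> nat) \<Rightarrow> nat \<Rightarrow> monitor" where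
  "monitor n r \<omega> 0 = ([1..<Suc n] @ schedule n, init_config r, 0, {})"
| "monitor n r \<omega> (Suc t) = monitor_step n (\<omega> t) (monitor n r \<omega> t)"

lemma move_execution_of:
  "move (execution_of A (r, \<omega>)) t =
    (let (h, c) = outcome A r \<omega> t in (A h, reg c (A h), reg (step (A h) (\<omega> t) c) (A h)))"
  by (simp add: move_def execution_of_def Let_def case_prod_beta)

text \<open>This links the monitor to the actual execution, so that invariants can be proved for
  single monitor steps without mentioning histories.\<close>

lemma monitor_eq:
  "monitor n r \<omega> t =
    (let (h, c) = outcome (adversary n) r \<omega> t; \<alpha> = execution_of (adversary n) (r, \<omega>)
     in (queue n h, c, wins_before \<alpha> t, participants_before \<alpha> t))"
proof (induction t)
  case 0
  then show ?case
    by (simp add: queue_def wins_before_def participants_before_def)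
next
  case (Suc t)
  obtain h c where hc: "outcome (adversary n) r \<omega> t = (h, c)"
    by fastforce
  have mv: "move (execution_of (adversary n) (r, \<omega>)) t =
      (front (queue n h), reg c (front (queue n h)), reg (step (front (queue n h)) (\<omega> t) c) (front (queue n h)))"
    by (simp add: move_execution_of hc adversary_def)
  have ec: "enters_crit (execution_of (adversary n) (r, \<omega>)) t \<longleftrightarrow>
      (reg c (front (queue n h)), reg (step (front (queue n h)) (\<omega> t) c) (front (queue n h))) = (Try, Crit)"
    by (simp add: enters_crit_def mv)
  have q: "queue n (h @ [m]) = requeue n (queue n h) (snd m)" for m
    by (simp add: queue_def)
  show ?case
    using Suc
    by (simp add: hc wins_before_Suc participants_before_Suc mv ec q Let_def adversary_def[symmetric]
        del: step.simps)
qed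

lemma move_monitor:
  assumes "monitor n r \<omega> t = (q, c, k, P)"
  shows "move (execution_of (adversary n) (r, \<omega>)) t =
    (front q, reg c (front q), reg (step (front q) (\<omega> t) c) (front q))"
  using assms
  by (simp add: move_execution_of monitor_eq adversary_def case_prod_beta Let_def del: step.simps)

lemma participants_monitor:
  assumes "monitor n r \<omega> t = (q, c, k, P)"
    and "reg c (front q) = Try" "reg (step (front q) (\<omega> t) c) (front q) = Crit"
  shows "participants (execution_of (adversary n) (r, \<omega>)) (Suc k) = insert (front q) P"
proof -
  have "round_end (execution_of (adversary n) (r, \<omega>)) (Suc k) t"
    using assms move_monitor[OF assms(1)]
    by (simp add: monitor_eq round_end_iff enters_crit_def case_prod_beta Let_def del: step.simps)
  from participants_round_end[OF this]
  show "participants (execution_of (adversary n) (r, \<omega>)) (Suc k) = insert (front q) P"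
    using assms(1) move_monitor[OF assms(1)]
    by (simp add: monitor_eq case_prod_beta Let_def del: step.simps)
qed


section \<open>Process 1 wins only alone or against everybody\<close>

primrec steps_to_Try :: "region \<Rightarrow> nat" where
  "steps_to_Try Try = 0"
| "steps_to_Try Crit = 3"
| "steps_to_Try Exit = 2"
| "steps_to_Try Rem = 1"

text \<open>The prefix \<open>p\<close> holds each process exactly as often as it needs to get back
  to \<open>Try\<close>. It is therefore used up exactly when all have arrived, and none of its
  steps starts in \<open>Try\<close>.\<close>

fun gathering :: "nat \<Rightarrow> monitor \<Rightarrow> bool" where
  "gathering n (q, c, k, P) \<longleftrightarrow>
    P = {} \<and> (\<exists>p. q = p @ schedule n \<and> (\<forall>j\<in>{1..n}. count_list p j = steps_to_Try (reg c j)))"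

text \<open>Every process that has not yet participated is still queued, and 1 is not. Process 1 can
  thus move again only through the default of \<open>front\<close>, when \<open>P\<close> already
  contains everybody.\<close>

fun competing :: "nat \<Rightarrow> monitor \<Rightarrow> bool" where
  "competing n (q, c, k, P) \<longleftrightarrow>
    1 \<notin> set q \<and> {1..n} \<subseteq> P \<union> set q \<and> (\<forall>j\<in>{1..n}. reg c j = Try)"

lemma reg_step_other: "j \<noteq> i \<Longrightarrow> reg (step i x c) j = reg c j"
  by (cases x) (auto split: region.split)

lemma reg_step_Try: "reg c i = Try \<Longrightarrow> reg (step i x c) i \<in> {Try, Crit}"
  by (cases x) auto

text \<open>Outside \<open>Try\<close> the region moves along a fixed cycle, whatever the random
  values are.\<close>

lemma steps_to_Try_step:
  "reg c i \<noteq> Try \<Longrightarrow>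
    steps_to_Try (reg c i) = Suc (steps_to_Try (reg (step i x c) i)) \<and> reg (step i x c) i \<noteq> Crit"
  by (cases x) (auto split: region.split)

text \<open>The three copies of the winner match \<open>steps_to_Try Crit\<close>; everyone else is
  in \<open>Try\<close> and needs none.\<close>

lemma monitor_step_win:
  assumes "\<forall>j\<in>{1..n}. reg c j = Try" "front q \<in> {1..n}"
    and "reg (step (front q) x c) (front q) = Crit"
  shows "gathering n (monitor_step n x (q, c, k, P))"
proof -
  have "\<forall>j\<in>{1..n}. count_list (replicate 3 (front q)) j = steps_to_Try (reg (step (front q) x c) j)"
  proof
    fix j assume "j \<in> {1..n}"
    then show "count_list (replicate 3 (front q)) j = steps_to_Try (reg (step (front q) x c) j)"
      using assms by (cases "j = front q") (auto simp: reg_step_other numeral_3_eq_3 simp del: step.simps)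
  qed
  then show ?thesis
    using assms by (auto simp: requeue_def Let_def simp del: step.simps)
qed

text \<open>A process in \<open>Try\<close> does not occur in the prefix \<open>p\<close>, so it can
  be at the front only if \<open>p\<close> is empty.\<close>

lemma gathering_Try:
  assumes "gathering n (q, c, k, P)" "front q \<in> {1..n}" "reg c (front q) = Try"
  shows "P = {}" "q = schedule n" "\<forall>j\<in>{1..n}. reg c j = Try"
proof -
  obtain p where p: "q = p @ schedule n"
    and cnt: "\<forall>j\<in>{1..n}. count_list p j = steps_to_Try (reg c j)"
    using assms(1) by auto
  have "count_list p (front q) = 0"
    using cnt assms by simp
  then have "p = []"
    using p by (cases p) (auto simp: front_def)
  then show "q = schedule n"
    using p by simp
  show "P = {}"
    using assms(1) by simp
  have "r = Try" if "steps_to_Try r = 0" for r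
    using that by (cases r) auto
  then show "\<forall>j\<in>{1..n}. reg c j = Try"
    using cnt \<open>p = []\<close> by simp
qed

text \<open>A step from outside \<open>Try\<close> can occur only while gathering and removes the
  head of the prefix. From \<open>Try\<close>, a win restarts gathering, and a failed attempt starts
  or continues competing.\<close>

lemma monitor_step_phases:
  assumes n: "n \<ge> 1" and q: "set q \<subseteq> {1..n}"
    and phase: "gathering n (q, c, k, P) \<or> competing n (q, c, k, P)"
  shows "gathering n (monitor_step n x (q, c, k, P)) \<or> competing n (monitor_step n x (q, c, k, P))"
proof -
  define i where "i = front q"
  define c' where "c' = step i x c"
  have i: "i \<in> {1..n}"
    using front_in[OF n q] by (simp add: i_def)
  show ?thesis
  proof (cases "reg c i = Try")
    case False
    then obtain p where P: "P = {}" and p: "q = p @ schedule n"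
      and cnt: "\<forall>j\<in>{1..n}. count_list p j = steps_to_Try (reg c j)"
      using phase i by auto
    have "count_list p i \<noteq> 0"
      using cnt i False by (cases "reg c i") auto
    then obtain p' where p': "p = i # p'"
      using p by (cases p) (auto simp: i_def front_def)
    have "count_list p' j = steps_to_Try (reg c' j)" if "j \<in> {1..n}" for j
      using cnt[rule_format, OF that] steps_to_Try_step[OF False, of x]
      by (cases "j = i") (auto simp: p' c'_def reg_step_other simp del: step.simps)
    then have "gathering n (tl q, c', k, {})"
      using p p' by auto
    then show ?thesis
      using False P by (simp add: requeue_def Let_def i_def c'_def del: step.simps gathering.simps competing.simps)
  next
    case True
    have q_all: "(P = {} \<and> q = schedule n \<or> competing n (q, c, k, P)) \<and>
        (\<forall>j\<in>{1..n}. reg c j = Try)"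
      using phase
    proof
      assume "gathering n (q, c, k, P)"
      then show ?thesis
        using gathering_Try[of n q c k P] i True unfolding i_def by blast
    qed simp
    then have all: "\<forall>j\<in>{1..n}. reg c j = Try"
      by blast
    show ?thesis
    proof (cases "reg c' i = Crit")
      case True
      then show ?thesis
        using monitor_step_win[OF all] i by (simp add: i_def c'_def)
    next
      case False
      then have "reg c' i = Try"
        using reg_step_Try[OF True, of x] by (simp add: c'_def)
      then have all': "\<forall>j\<in>{1..n}. reg c' j = Try"
        using all by (metis c'_def reg_step_other)
      \<comment> \<open>The first step of the schedule removes the only queued 1 and makes it a
        participant. Later steps just transfer the mover from the queue to \<open>P\<close>; an
        empty queue stays empty.\<close>
      have "1 \<notin> set (tl q) \<and> {1..n} \<subseteq> insert i P \<union> set (tl q)"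
        using q_all[THEN conjunct1]
      proof
        assume "P = {} \<and> q = schedule n"
        then show ?thesis
          by (auto simp: schedule_def set_double_steps i_def front_def)
      next
        assume "competing n (q, c, k, P)"
        then show ?thesis
          by (cases q) (auto simp: i_def front_def)
      qed
      then have "competing n (tl q, c', k, insert i P)"
        using all' by simp
      then show ?thesis
        using True False
        by (simp add: requeue_def Let_def i_def c'_def del: step.simps gathering.simps competing.simps)
    qed
  qed
qed

lemma count_list_distinct: "distinct xs \<Longrightarrow> x \<in> set xs \<Longrightarrow> count_list xs x = 1"
  by (induction xs) auto

lemma monitor_phases:
  assumes n: "n \<ge> 1"
  shows "gathering n (monitor n r \<omega> t) \<or> competing n (monitor n r \<omega> t)"
proof (induction t)
  case 0
  \<comment> \<open>All processes start in \<open>Rem\<close>, one step away from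
    \<open>Try\<close>.\<close>
  have "\<forall>j\<in>{1..n}. count_list [1..<Suc n] j = 1"
    by (intro ballI count_list_distinct) auto
  then show ?case
    by (auto simp: init_config_def simp del: upt_Suc)
next
  case (Suc t)
  obtain q c k P where m: "monitor n r \<omega> t = (q, c, k, P)"
    by (metis prod_cases4)
  then have "set q \<subseteq> {1..n}"
    using set_queue[OF n] by (auto simp: monitor_eq case_prod_beta Let_def)
  then show ?case
    using monitor_step_phases[OF n] Suc m by simp
qed

text \<open>While gathering nobody else has participated; while competing process 1 is at the front
  only if the queue is empty, and then all have participated.\<close>

lemma card_participants_if_wins_1:
  assumes n: "n \<ge> 1" and "wins (execution_of (adversary n) (r, \<omega>)) 1 k"
  shows "card (participants (execution_of (adversary n) (r, \<omega>)) k) = 1 \<or>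
    n \<le> card (participants (execution_of (adversary n) (r, \<omega>)) k)"
    (is "card ?Q = 1 \<or> _")
proof -
  let ?\<alpha> = "execution_of (adversary n) (r, \<omega>)"
  obtain t where t: "round_end ?\<alpha> k t" "move ?\<alpha> t = (1, Try, Crit)"
    using assms by (auto simp: wins_def)
  obtain q c l P where m: "monitor n r \<omega> t = (q, c, l, P)"
    by (metis prod_cases4)
  have f: "front q = 1" "reg c 1 = Try"
    using move_monitor[OF m] t(2) by (auto simp del: step.simps)
  have P: "P = participants_before ?\<alpha> t"
    using m by (simp add: monitor_eq case_prod_beta Let_def)
  have Q: "?Q = insert 1 P"
    using participants_round_end[OF t(1)] t(2) P by simp
  have "?Q \<subseteq> {1..n}"
    using is_adversary_adversary[OF n]
    by (auto simp: participants_def move_execution_of is_adversary_def case_prod_beta Let_def)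
  \<comment> \<open>Needed for \<open>card_mono\<close>, since \<open>card\<close> of an infinite
    set would be 0.\<close>
  then have fin: "finite ?Q"
    by (rule finite_subset) simp
  from monitor_phases[OF n, of r \<omega> t] show ?thesis
  proof
    assume "gathering n (monitor n r \<omega> t)"
    then show ?thesis
      using m Q by simp
  next
    assume c: "competing n (monitor n r \<omega> t)"
    then have "q = []"
      using m f by (cases q) (auto simp: front_def)
    then have "{1..n} \<subseteq> ?Q"
      using c m Q by auto
    then show ?thesis
      using card_mono[OF fin, of "{1..n}"] by simp
  qed
qed


section \<open>Process \<open>m\<close> can win any round with participants \<open>1, \<dots>, m\<close>\<close>

text \<open>Only choices of positive probability are allowed: lottery values 1 and 2, and 0 for
  every \<open>R\<close> value. A reachable state therefore occurs with positive
  probability.\<close>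

inductive reachable :: "nat \<Rightarrow> monitor \<Rightarrow> bool" for n where
  reachable_init: "reachable n ([1..<Suc n] @ schedule n, init_config 0, 0, {})"
| reachable_step: "reachable n s \<Longrightarrow> l \<in> {1, 2} \<Longrightarrow> reachable n (monitor_step n (l, 0) s)"

lemma reachable_choices:
  assumes "reachable n s"
  shows "\<exists>xs. set xs \<subseteq> {1, 2} \<times> {0} \<and>
    (\<forall>\<omega>. (\<forall>t<length xs. \<omega> t = xs ! t) \<longrightarrow> monitor n 0 \<omega> (length xs) = s)"
  using assms
proof induction
  case reachable_init
  show ?case by (rule exI[of _ "[]"]) simp
next
  case (reachable_step s l)
  obtain xs where xs: "set xs \<subseteq> {1, 2} \<times> {0}"
    "\<And>\<omega>. (\<forall>t<length xs. \<omega> t = xs ! t) \<Longrightarrow> monitor n 0 \<omega> (length xs) = s"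
    using reachable_step.IH by blast
  have "monitor n 0 \<omega> (length (xs @ [(l, 0)])) = monitor_step n (l, 0) s"
    if \<omega>: "\<forall>t<length (xs @ [(l, 0)]). \<omega> t = (xs @ [(l, 0)]) ! t" for \<omega>
  proof -
    have "\<omega> t = xs ! t" if "t < length xs" for t
      using \<omega>[rule_format, of t] that by (simp add: nth_append)
    moreover have "\<omega> (length xs) = (l, 0)"
      using \<omega>[rule_format, of "length xs"] by simp
    ultimately show ?thesis
      using xs(2)[of \<omega>] by simp
  qed
  then show ?case
    using xs(1) reachable_step.hyps by (intro exI[of _ "xs @ [(l, 0)]"]) auto
qed

text \<open>Process 1 may keep an \<open>R\<close> value from a lost round that equals
  \<open>shR\<close>; then only \<open>shB c < locB c 1\<close> makes it redraw. For the other
  processes \<open>None\<close> forces a draw.\<close>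

definition round_start :: "nat \<Rightarrow> config \<Rightarrow> bool" where
  "round_start n c \<longleftrightarrow> shS c = 0 \<and> shB c = 0 \<and> shR c = 0 \<and> (locR c 1 \<noteq> None \<longrightarrow> locB c 1 \<ge> 1) \<and>
    (\<forall>j\<in>{2..n}. locR c j = None) \<and> (\<forall>j\<in>{1..n}. reg c j = Try)"

lemma reachable_first_round:
  "\<exists>c. reachable n (schedule n, c, 0, {}) \<and> round_start n c"
proof -
  \<comment> \<open>Generalised to the moment when exactly the first \<open>i\<close> processes have
    entered \<open>Try\<close>.\<close>
  have "i \<le> n \<Longrightarrow> reachable n ([Suc i..<Suc n] @ schedule n,
      (init_config 0)\<lparr>reg := (\<lambda>j. if 1 \<le> j \<and> j \<le> i then Try else Rem)\<rparr>, 0, {})" for i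
  proof (induction i)
    case 0
    have "(init_config 0)\<lparr>reg := (\<lambda>j. if 1 \<le> j \<and> j \<le> 0 then Try else Rem)\<rparr> = init_config 0"
      by (auto simp: init_config_def)
    then show ?case
      using reachable_init[of n] by (simp del: upt_Suc)
  next
    case (Suc i)
    let ?c = "\<lambda>i. (init_config 0)\<lparr>reg := (\<lambda>j. if 1 \<le> j \<and> j \<le> i then Try else Rem)\<rparr>"
    have "step (Suc i) (1, 0) (?c i) = ?c (Suc i)"
      by (auto simp: init_config_def)
    moreover have "[Suc i..<Suc n] = Suc i # [Suc (Suc i)..<Suc n]"
      using Suc.prems by (simp add: upt_conv_Cons del: upt_Suc)
    ultimately show ?case
      using reachable_step[OF Suc.IH, of 1] Suc.prems
      by (simp add: front_def requeue_def Let_def del: upt_Suc step.simps)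
  qed
  from this[of n] show ?thesis
    by (intro exI conjI) (auto simp: round_start_def init_config_def)
qed

text \<open>Processes 1 and 2 both draw 1, so 2 attains the maximum and wins at its second step. Its
  exit resets \<open>locR\<close> to \<open>None\<close>, process 1 keeps \<open>locB\<close> equal
  to 1, and nobody else has moved.\<close>

lemma reachable_next_round:
  assumes n: "n \<ge> 2" and reach: "reachable n (schedule n, c, k, {})" and c: "round_start n c"
  shows "\<exists>c'. reachable n (schedule n, c', Suc k, {}) \<and> round_start n c'"
proof -
  obtain q where q: "schedule n = 1 # 2 # 2 # q"
    using n double_steps_simps[of 2 n] by (simp add: schedule_def)
  have R1: "reg c 1 = Try" "reg c 2 = Try" "reg c (Suc 0) = Try" and L2: "locR c 2 = None"
    and S: "shS c = 0" "shB c = 0" "shR c = 0"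
    using c n by (auto simp: round_start_def)
  define c1 where "c1 = c\<lparr>shB := 1, locB := (locB c)(1 := 1), locR := (locR c)(1 := Some 0)\<rparr>"
  define c2 where "c2 = c1\<lparr>locB := (locB c1)(2 := 1), locR := (locR c1)(2 := Some 0)\<rparr>"
  define c3 where "c3 = c2\<lparr>shS := 1, shB := 0, shR := 0, reg := (reg c2)(2 := Crit)\<rparr>"
  define c4 where "c4 = c3\<lparr>reg := (reg c3)(2 := Exit)\<rparr>"
  define c5 where "c5 = c4\<lparr>shS := 0, locB := (locB c4)(2 := 0), locR := (locR c4)(2 := None),
    reg := (reg c4)(2 := Rem)\<rparr>"
  define c6 where "c6 = c5\<lparr>reg := (reg c5)(2 := Try)\<rparr>"
  have s1: "step 1 (1, 0) c = c1"
    using c R1 S by (cases "locR c 1") (auto simp: c1_def round_start_def)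
  have s2: "step 2 (1, 0) c1 = c2"
    using R1 L2 S by (simp add: c1_def c2_def)
  have s3: "step 2 (1, 0) c2 = c3"
    using R1 S by (simp add: c1_def c2_def c3_def)
  have s4: "step 2 (1, 0) c3 = c4"
    by (simp add: c3_def c4_def)
  have s5: "step 2 (1, 0) c4 = c5"
    by (simp add: c4_def c5_def)
  have s6: "step 2 (1, 0) c5 = c6"
    by (simp add: c5_def c6_def)
  note [simp] = front_def requeue_def Let_def
  note [simp del] = step.simps
  have "reachable n (2 # 2 # q, c1, k, {1})"
    using reachable_step[OF reach, of 1] s1 R1 by (simp add: q c1_def)
  from reachable_step[OF this, of 1] have "reachable n (2 # q, c2, k, {1, 2})"
    using s2 R1 by (simp add: c1_def c2_def insert_commute)
  from reachable_step[OF this, of 1] have "reachable n (replicate 3 2 @ schedule n, c3, Suc k, {})"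
    using s3 R1 by (simp add: c1_def c2_def c3_def)
  from reachable_step[OF this, of 1] have "reachable n (replicate 2 2 @ schedule n, c4, Suc k, {})"
    using s4 by (simp add: c3_def c4_def numeral_3_eq_3 numeral_2_eq_2)
  from reachable_step[OF this, of 1] have "reachable n (2 # schedule n, c5, Suc k, {})"
    using s5 by (simp add: c4_def c5_def numeral_2_eq_2)
  from reachable_step[OF this, of 1] have "reachable n (schedule n, c6, Suc k, {})"
    using s6 by (simp add: c5_def c6_def)
  moreover have "round_start n c6"
    using c by (auto simp: round_start_def c1_def c2_def c3_def c4_def c5_def c6_def)
  ultimately show ?thesis by blast
qed

lemma reachable_round_start:
  assumes "n \<ge> 2"
  shows "\<exists>c. reachable n (schedule n, c, k, {}) \<and> round_start n c"
proof (induction k)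
  case 0
  show ?case by (rule reachable_first_round)
next
  case (Suc k)
  then show ?case using reachable_next_round[OF assms] by blast
qed

text \<open>The draw 2 of process 1 fixes the maximum; each following process draws 1, falls short
  of it and wastes its second step.\<close>

lemma reachable_losers:
  assumes "2 \<le> m" "m \<le> n"
  shows "\<exists>c. reachable n (double_steps m n, c, k, {1..<m}) \<and> shS c = 0 \<and> shB c = 2 \<and> shR c = 0 \<and>
    (\<forall>j\<in>{m..n}. locR c j = None) \<and> (\<forall>j\<in>{1..n}. reg c j = Try)"
  using assms
proof (induction m rule: dec_induct)
  case base
  obtain c where reach: "reachable n (schedule n, c, k, {})" and c: "round_start n c"
    using reachable_round_start[of n k] base by auto
  have R1: "reg c 1 = Try" and S: "shS c = 0" "shB c = 0" "shR c = 0"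
    using c base by (auto simp: round_start_def)
  define c1 where "c1 = c\<lparr>shB := 2, locB := (locB c)(1 := 2), locR := (locR c)(1 := Some 0)\<rparr>"
  have s1: "step 1 (2, 0) c = c1"
    using c R1 S by (cases "locR c 1") (auto simp: c1_def round_start_def)
  have "{1..<2} = {1::nat}"
    by auto
  then have "reachable n (double_steps 2 n, c1, k, {1..<2})"
    using reachable_step[OF reach, of 2] s1 R1
    by (simp add: schedule_def front_def requeue_def Let_def c1_def del: step.simps)
  then show ?case
    using c by (intro exI[of _ c1]) (auto simp: round_start_def c1_def)
next
  case (step i)
  obtain c where reach: "reachable n (double_steps i n, c, k, {1..<i})"
    and S: "shS c = 0" "shB c = 2" "shR c = 0"
    and L: "\<forall>j\<in>{i..n}. locR c j = None" and R: "\<forall>j\<in>{1..n}. reg c j = Try"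
    using step by auto
  define c1 where "c1 = c\<lparr>locB := (locB c)(i := 1), locR := (locR c)(i := Some 0)\<rparr>"
  have Ri: "reg c i = Try" and Li: "locR c i = None"
    using R L step by auto
  have s1: "step i (1, 0) c = c1"
    using S Ri Li by (simp add: c1_def)
  \<comment> \<open>The entry test fails because 1 differs from 2, and the redraw guard fails
    because \<open>locR\<close> is current and \<open>shB\<close> exceeds
    \<open>locB\<close>.\<close>
  have s2: "step i (1, 0) c1 = c1"
    using S Ri by (simp add: c1_def)
  have Q: "double_steps i n = i # i # double_steps (Suc i) n"
    using double_steps_simps[of i n] step by simp
  have P: "{1..<Suc i} = insert i {1..<i}"
    using step by auto
  have "reachable n (i # double_steps (Suc i) n, c1, k, {1..<Suc i})"
    using reachable_step[OF reach, of 1] s1 Ri Q P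
    by (simp add: front_def requeue_def Let_def c1_def del: step.simps)
  from reachable_step[OF this, of 1] have "reachable n (double_steps (Suc i) n, c1, k, {1..<Suc i})"
    using s2 Ri P by (simp add: front_def requeue_def Let_def c1_def del: step.simps)
  then show ?case
    using S L R by (intro exI[of _ c1]) (auto simp: c1_def)
qed

text \<open>Drawing 2 ties with the maximum. The state is taken between the two steps of
  \<open>m\<close>; the entry test of the second does not depend on the random values, hence the
  quantified \<open>x\<close>.\<close>

lemma reachable_winner:
  assumes m: "2 \<le> m" "m \<le> n"
  shows "\<exists>q c. reachable n (m # q, c, k, {1..m}) \<and> reg c m = Try \<and>
    (\<forall>x. reg (step m x c) m = Crit)"
proof -
  obtain c where reach: "reachable n (double_steps m n, c, k, {1..<m})"
    and S: "shS c = 0" "shB c = 2" "shR c = 0" and L: "locR c m = None" and R: "reg c m = Try"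
    using reachable_losers[OF m, of k] m by auto
  define c1 where "c1 = c\<lparr>locB := (locB c)(m := 2), locR := (locR c)(m := Some 0)\<rparr>"
  have s1: "step m (2, 0) c = c1"
    using S R L by (simp add: c1_def)
  have "{1..m} = insert m {1..<m}"
    using m by auto
  then have "reachable n (m # double_steps (Suc m) n, c1, k, {1..m})"
    using reachable_step[OF reach, of 2] s1 R double_steps_simps[of m n] m
    by (simp add: front_def requeue_def Let_def c1_def del: step.simps)
  moreover have "\<forall>x. reg (step m x c1) m = Crit"
    using S R by (simp add: c1_def)
  ultimately show ?thesis
    using R by (intro exI[of _ "double_steps (Suc m) n"] exI[of _ c1]) (auto simp: c1_def)
qed


section \<open>Probabilities\<close>

lemma bmax_ge_4: "bmax n \<ge> 4"
  by (simp add: bmax_def)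

text \<open>By independence, the measure is a finite product of point masses. They are positive
  because 1 and 2 lie below \<open>bmax n\<close>.\<close>

lemma measure_choice_cylinder_pos:
  assumes xs: "set xs \<subseteq> {1, 2} \<times> {0}"
  shows "0 < measure (choice_space n)
    {x \<in> space (choice_space n). fst x = 0 \<and> (\<forall>t<length xs. snd x t = xs ! t)}"
    (is "0 < measure _ ?C")
proof -
  let ?D = "measure_pmf (pair_pmf (lottery (bmax n)) uniform_R)"
  let ?N = "\<Pi>\<^sub>M t\<in>(UNIV :: nat set). ?D"
  let ?J = "{..<length xs}"
  let ?E = "prod_emb UNIV (\<lambda>_. ?D) ?J (Pi\<^sub>E ?J (\<lambda>t. {xs ! t}))"
  interpret N: product_prob_space "\<lambda>_. ?D" "UNIV :: nat set"
    by standard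
  have C: "?C = {0} \<times> ?E"
    by (auto simp: choice_space_def space_pair_measure space_PiM prod_emb_iff restrict_PiE_iff)
  have "measure (choice_space n) ?C = measure (measure_pmf uniform_R) {0} * measure ?N ?E"
    unfolding C by (simp add: choice_space_def measure_def N.emeasure_pair_measure_Times enn2real_mult sets_PiM_I)
  also have "measure ?N ?E = (\<Prod>t\<in>?J. measure ?D {xs ! t})"
    by (rule N.measure_PiM_emb) auto
  also have "measure (measure_pmf uniform_R) {0} * \<dots> > 0"
  proof (intro mult_pos_pos prod_pos)
    show "measure (measure_pmf uniform_R) {0} > 0"
      by (simp add: measure_pmf_single uniform_R_def)
    fix t assume "t \<in> ?J"
    then have "xs ! t \<in> {1, 2} \<times> {0}"
      using xs nth_mem by blast
    then show "measure ?D {xs ! t} > 0"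
      using bmax_ge_4[of n]
      by (auto simp: measure_pmf_single pmf_pair uniform_R_def pmf_lottery)
  qed
  finally show ?thesis .
qed

lemma prob_exec_measure:
  assumes "Measurable.pred execution_space Q"
  shows "\<P>(\<alpha> in exec_measure n A. Q \<alpha>) = \<P>(x in choice_space n. Q (execution_of A x))"
proof -
  have "{\<alpha> \<in> space execution_space. Q \<alpha>} \<in> sets execution_space"
    using assms by simp
  moreover have "execution_of A -` {\<alpha> \<in> space execution_space. Q \<alpha>} \<inter> space (choice_space n) =
      {x \<in> space (choice_space n). Q (execution_of A x)}"
    using measurable_space[OF measurable_execution_of] by auto
  ultimately show ?thesis
    by (simp add: exec_measure_def measure_distr[OF measurable_execution_of])
qed

lemma prob_participants_pos:
  assumes m: "2 \<le> m" "m \<le> n"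
  shows "\<P>(\<alpha> in exec_measure n (adversary n).
    1 \<in> participants \<alpha> (Suc k) \<and> card (participants \<alpha> (Suc k)) = m) > 0"
    (is "\<P>(\<alpha> in _. ?Q \<alpha>) > 0")
proof -
  interpret prob_space "choice_space n"
    by (rule prob_space_choice_space)
  obtain q c where reach: "reachable n (m # q, c, k, {1..m})"
    and R: "reg c m = Try" "\<And>x. reg (step m x c) m = Crit"
    using reachable_winner[OF m, of k] by auto
  obtain xs where xs: "set xs \<subseteq> {1, 2} \<times> {0}"
    and mon: "\<And>\<omega>. (\<forall>t<length xs. \<omega> t = xs ! t) \<Longrightarrow>
      monitor n 0 \<omega> (length xs) = (m # q, c, k, {1..m})"
    using reachable_choices[OF reach] by blast
  \<comment> \<open>The choices after \<open>xs\<close> are free: \<open>m\<close> wins at step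
    \<open>length xs\<close> in any case, which settles the participants of the round.\<close>
  have Q: "?Q (execution_of (adversary n) (0, \<omega>))" if "\<forall>t<length xs. \<omega> t = xs ! t" for \<omega>
  proof -
    have "participants (execution_of (adversary n) (0, \<omega>)) (Suc k) = insert m {1..m}"
      using participants_monitor[OF mon[OF that]] R by (simp add: front_def del: step.simps)
    also have "\<dots> = {1..m}"
      using m by auto
    finally show ?thesis
      using m by simp
  qed
  have pred: "Measurable.pred execution_space ?Q"
    by measurable
  have "0 < prob {x \<in> space (choice_space n). fst x = 0 \<and> (\<forall>t<length xs. snd x t = xs ! t)}"
    by (rule measure_choice_cylinder_pos[OF xs])
  also have "\<dots> \<le> \<P>(x in choice_space n. ?Q (execution_of (adversary n) x))"
  proof (rule finite_measure_mono)
    show "{x \<in> space (choice_space n). fst x = 0 \<and> (\<forall>t<length xs. snd x t = xs ! t)} \<subseteq>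
        {x \<in> space (choice_space n). ?Q (execution_of (adversary n) x)}"
      using Q by auto
    show "{x \<in> space (choice_space n). ?Q (execution_of (adversary n) x)} \<in> events"
      using measurable_compose[OF measurable_execution_of pred] by simp
  qed
  finally show ?thesis
    by (simp only: prob_exec_measure[OF pred])
qed

text \<open>The numerator of \<open>cond_prob\<close> is the measure of an impossible event, as
  \<open>m\<close> is neither 1 nor at least \<open>n\<close>. That the denominator is nonzero is
  \<open>prob_participants_pos\<close>.\<close>

lemma cond_prob_wins_1:
  assumes m: "2 \<le> m" "m \<le> n - 1"
  shows "\<P>(\<alpha> in exec_measure n (adversary n). wins \<alpha> 1 k \<bar>
    1 \<in> participants \<alpha> k \<and> card (participants \<alpha> k) = m) = 0"
proof -
  let ?Q = "\<lambda>\<alpha>. wins \<alpha> 1 k \<and> 1 \<in> participants \<alpha> k \<and> card (participants \<alpha> k) = m"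
  have "\<not> ?Q (execution_of (adversary n) x)" for x
    using card_participants_if_wins_1[of n "fst x" "snd x" k] m by force
  then have "{x \<in> space (choice_space n). ?Q (execution_of (adversary n) x)} = {}"
    by blast
  then have "\<P>(x in choice_space n. ?Q (execution_of (adversary n) x)) = 0"
    by (simp only: measure_empty)
  moreover have "Measurable.pred execution_space ?Q"
    by measurable
  ultimately have "\<P>(\<alpha> in exec_measure n (adversary n). ?Q \<alpha>) = 0"
    by (simp only: prob_exec_measure)
  then show ?thesis
    by (simp add: cond_prob_def)
qed

theorem theorem3p1:
  fixes n :: nat
  assumes "n \<ge> 1"
  shows "(n \<ge> 3 \<longrightarrow> \<not> strong_no_lockout_without_knowledge n) \<and>
    (\<exists>A. is_adversary n A \<and>
      (\<forall>k\<ge>1. \<forall>m. 2 \<le> m \<and> m \<le> n - 1 \<longrightarrow>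
        \<P>(\<alpha> in exec_measure n A. 1 \<in> participants \<alpha> k \<and> card (participants \<alpha> k) = m) \<noteq> 0 \<and>
        \<P>(\<alpha> in exec_measure n A. wins \<alpha> 1 k \<bar>
            1 \<in> participants \<alpha> k \<and> card (participants \<alpha> k) = m) = 0))"
proof -
  let ?A = "adversary n"
  have adv: "is_adversary n ?A"
    by (rule is_adversary_adversary[OF assms])
  have main: "\<P>(\<alpha> in exec_measure n ?A. 1 \<in> participants \<alpha> k \<and> card (participants \<alpha> k) = m) \<noteq> 0 \<and>
      \<P>(\<alpha> in exec_measure n ?A. wins \<alpha> 1 k \<bar>
        1 \<in> participants \<alpha> k \<and> card (participants \<alpha> k) = m) = 0"
    if "k \<ge> 1" "2 \<le> m" "m \<le> n - 1" for k m
  proof -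
    have "m \<le> n"
      using that by simp
    then show ?thesis
      \<comment> \<open>The positivity result is stated for round \<open>Suc k\<close>, hence the
        shift to \<open>k - 1\<close>.\<close>
      using prob_participants_pos[of m n "k - 1"] cond_prob_wins_1[of m n k] that by simp
  qed
  have "\<not> strong_no_lockout_without_knowledge n" if n: "n \<ge> 3"
  proof
    assume "strong_no_lockout_without_knowledge n"
    then obtain c :: real where "c > 0"
      and c: "\<And>A k i m. \<lbrakk>is_adversary n A; k \<ge> 1; i \<in> {1..n}; m \<in> {1..n};
        \<P>(\<alpha> in exec_measure n A. i \<in> participants \<alpha> k \<and> card (participants \<alpha> k) = m) \<noteq> 0\<rbrakk> \<Longrightarrow>
        \<P>(\<alpha> in exec_measure n A. wins \<alpha> i k \<bar>
          i \<in> participants \<alpha> k \<and> card (participants \<alpha> k) = m) \<ge> c / real m"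
      unfolding strong_no_lockout_without_knowledge_def by blast
    show False
      \<comment> \<open>In round 1 with \<open>m = 2\<close>, admissible as \<open>n\<close> is at
        least 3, the bound would give \<open>c / 2 \<le> 0\<close>.\<close>
      using c[OF adv, of 1 1 2] main[of 1 2] n \<open>c > 0\<close> by simp
  qed
  then show ?thesis
    using adv main by blast
qed

end
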